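(* Let $v>r>2$ be integers such that a Steiner system $S(2,r,v)$ exists. If $k=\frac{v(v-1)}{r(r-1)}$ and $n$ is any positive integer divisible by $v$, then $M(k,n)\geq\frac{v}{r}(n-1)$.
   Context: A Steiner system $S(2,r,v)$ is a collection of $r$-element subsets (blocks) of a $v$-element set such that every pair of elements lies in exactly one block. For a finite graph $G$, $\mathrm{Mad}(G)=\max\{2e(H)/|V(H)| : H\subseteq G,\ |V(H)|\geq 1\}$. $M(k,n)$ is the maximum of $\sum_{i=1}^k\mathrm{Mad}(G_i)$ over all partitions of $E(K_n)$ into $k$ spanning subgraphs $G_1,\dots,G_k$. *)

theory Defs
  imports Complex_Main "HOL-Library.Disjoint_Sets" "HOL-Library.FuncSet"
begin

type_synonym 'a graph = "'a set \<times> 'a set set"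

abbreviation verts :: "'a graph \<Rightarrow> 'a set" where "verts \<equiv> fst"
abbreviation edges :: "'a graph \<Rightarrow> 'a set set" where "edges \<equiv> snd"

definition simple_graph :: "'a graph \<Rightarrow> bool" where
  "simple_graph G \<longleftrightarrow> edges G \<subseteq> {e. e \<subseteq> verts G \<and> card e = 2}"

definition subgraph :: "'a graph \<Rightarrow> 'a graph \<Rightarrow> bool" where
  "subgraph H G \<longleftrightarrow> simple_graph H \<and> verts H \<subseteq> verts G \<and> edges H \<subseteq> edges G"

definition spanning_subgraph :: "'a graph \<Rightarrow> 'a graph \<Rightarrow> bool" where
  "spanning_subgraph H G \<longleftrightarrow> subgraph H G \<and> verts H = verts G"

definition complete_graph :: "nat \<Rightarrow> nat graph" where
  "complete_graph n = ({1..n}, {e. e \<subseteq> {1..n} \<and> card e = 2})"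

definition Mad :: "'a graph \<Rightarrow> real" where
  "Mad G = Max {2 * real (card (edges H)) / real (card (verts H)) | H.
                  subgraph H G \<and> card (verts H) \<ge> 1}"

(* Individual parts of a partition may have no edges. *)
definition edge_partition :: "nat \<Rightarrow> 'a graph \<Rightarrow> (nat \<Rightarrow> 'a graph) \<Rightarrow> bool" where
  "edge_partition k K G \<longleftrightarrow>
     (\<forall>i\<in>{1..k}. spanning_subgraph (G i) K) \<and>
     disjoint_family_on (\<lambda>i. edges (G i)) {1..k} \<and>
     (\<Union>i\<in>{1..k}. edges (G i)) = edges K"

definition M :: "nat \<Rightarrow> nat \<Rightarrow> real" where
  "M k n = Max {(\<Sum>i=1..k. Mad (G i)) | G. edge_partition k (complete_graph n) G}"

definition steiner_system :: "nat \<Rightarrow> nat \<Rightarrow> 'a set \<Rightarrow> 'a set set \<Rightarrow> bool" where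
  "steiner_system r v X \<B> \<longleftrightarrow>
     finite X \<and> card X = v \<and>
     (\<forall>B\<in>\<B>. B \<subseteq> X \<and> card B = r) \<and>
     (\<forall>x\<in>X. \<forall>y\<in>X. x \<noteq> y \<longrightarrow> (\<exists>!B. B \<in> \<B> \<and> x \<in> B \<and> y \<in> B))"

text \<open>The sets whose maxima are taken above are finite and nonempty.\<close>

lemma finite_Mad_set:
  assumes "finite (verts G)"
  shows "finite {2 * real (card (edges H)) / real (card (verts H)) | H.
                  subgraph H G \<and> card (verts H) \<ge> 1}"
proof (rule finite_subset)
  show "{2 * real (card (edges H)) / real (card (verts H)) | H.
           subgraph H G \<and> card (verts H) \<ge> 1}
        \<subseteq> (\<lambda>H. 2 * real (card (edges H)) / real (card (verts H))) `
            (Pow (verts G) \<times> Pow (Pow (verts G)))"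
    by (fastforce simp: subgraph_def simple_graph_def)
qed (use assms in simp)

lemma nonempty_Mad_set:
  assumes "verts G \<noteq> {}"
  shows "{2 * real (card (edges H)) / real (card (verts H)) | H.
           subgraph H G \<and> card (verts H) \<ge> 1} \<noteq> {}"
proof -
  from assms obtain x where "x \<in> verts G" by blast
  then have "subgraph ({x}, {}) G \<and> card (verts ({x}, {} :: 'a set set)) \<ge> 1"
    by (simp add: subgraph_def simple_graph_def)
  then show ?thesis by blast
qed

lemma finite_M_set:
  "finite {(\<Sum>i=1..k. Mad (G i)) | G. edge_partition k (complete_graph n) G}"
proof (rule finite_subset)
  let ?S = "Pow {1..n} \<times> Pow (Pow {1..n})"
  show "{(\<Sum>i=1..k. Mad (G i)) | G. edge_partition k (complete_graph n) G}
        \<subseteq> (\<lambda>G. \<Sum>i=1..k. Mad (G i)) ` ({1..k} \<rightarrow>\<^sub>E ?S)"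
  proof
    fix s assume "s \<in> {(\<Sum>i=1..k. Mad (G i)) | G. edge_partition k (complete_graph n) G}"
    then obtain G where s: "s = (\<Sum>i=1..k. Mad (G i))"
      and G: "edge_partition k (complete_graph n) G" by blast
    have mem: "G i \<in> ?S" if "i \<in> {1..k}" for i
    proof -
      have "spanning_subgraph (G i) (complete_graph n)"
        using G that by (auto simp: edge_partition_def)
      then show ?thesis
        by (cases "G i") (auto simp: spanning_subgraph_def subgraph_def complete_graph_def)
    qed
    have "restrict G {1..k} \<in> {1..k} \<rightarrow>\<^sub>E ?S" using mem by (simp add: restrict_PiE_iff)
    moreover have "s = (\<Sum>i=1..k. Mad (restrict G {1..k} i))" unfolding s by simp
    ultimately show "s \<in> (\<lambda>G. \<Sum>i=1..k. Mad (G i)) ` ({1..k} \<rightarrow>\<^sub>E ?S)" by blast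
  qed
qed (simp add: finite_PiE)

lemma nonempty_M_set:
  assumes "k \<ge> 1"
  shows "{(\<Sum>i=1..k. Mad (G i)) | G. edge_partition k (complete_graph n) G} \<noteq> {}"
proof -
  define G where "G i = (if i = (1::nat) then complete_graph n else ({1..n}, {}))" for i
  have "edge_partition k (complete_graph n) G"
    using assms unfolding edge_partition_def G_def
    by (auto simp: spanning_subgraph_def subgraph_def simple_graph_def complete_graph_def
        disjoint_family_on_def subset_iff split: if_splits)
  then show ?thesis by blast
qed

end

theory Submission
  imports Defs
begin

text \<open>
  Write \<open>n = v * m\<close>, blow up every point of the Steiner system to \<open>m\<close> vertices, and assign each edge
  of the complete graph to a block whose blow-up \<open>W\<close> contains it; for an edge inside the blow-up of
  a single point any block through that point will do. Every \<open>W\<close> has \<open>r * m\<close> vertices, so the part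
  with \<open>e\<close> edges has \<open>Mad \<ge> 2 * e / (r * m)\<close>, and since the numbers of edges add up to
  \<open>n * (n - 1) / 2\<close>, the sum of these bounds is \<open>n * (n - 1) / (r * m) = v / r * (n - 1)\<close>
  however the edges were assigned.
\<close>

lemma real_choose_two: "real (n choose 2) = real n * (real n - 1) / 2"
  by (simp add: binomial_gbinomial gbinomial_prod_rev numeral_2_eq_2)

lemma Mad_ge:
  assumes "finite (verts G)" "subgraph H G" "verts H \<noteq> {}"
  shows "2 * real (card (edges H)) / real (card (verts H)) \<le> Mad G"
proof -
  have "finite (verts H)"
    using assms(1,2) by (auto simp: subgraph_def intro: finite_subset)
  then have "card (verts H) \<ge> 1"
    using assms(3) by (simp add: Suc_leI card_gt_0_iff)
  then show ?thesis
    unfolding Mad_def using finite_Mad_set[OF assms(1)] assms(2) by (intro Max_ge) blast+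
qed

lemma M_ge:
  assumes "edge_partition k (complete_graph n) G"
  shows "(\<Sum>i=1..k. Mad (G i)) \<le> M k n"
  unfolding M_def using finite_M_set assms by (intro Max_ge) auto

text \<open>Giving the assignment as a function \<open>f\<close> makes the parts disjoint and
  exhaustive at once. A value that \<open>f\<close> never takes yields a part without edges, which
  is allowed.\<close>

lemma edge_partition_fibres:
  assumes "simple_graph K" "\<And>e. e \<in> edges K \<Longrightarrow> f e \<in> {1..k}"
  shows "edge_partition k K (\<lambda>i. (verts K, {e \<in> edges K. f e = i}))"
  using assms
  by (auto simp: edge_partition_def spanning_subgraph_def subgraph_def simple_graph_def
      disjoint_family_on_def)

lemma steiner_system_ex1_block:
  assumes "steiner_system r v X \<B>" "e \<subseteq> X" "card e = 2"
  shows "\<exists>!B. B \<in> \<B> \<and> e \<subseteq> B"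
proof -
  obtain x y where e: "e = {x, y}" and "x \<noteq> y"
    using assms(3) by (auto simp: card_2_iff)
  then show ?thesis
    using assms(1,2) by (auto simp: steiner_system_def)
qed

lemma steiner_system_finite_blocks:
  assumes "steiner_system r v X \<B>"
  shows "finite \<B>"
proof (rule finite_subset)
  show "\<B> \<subseteq> Pow X" using assms by (auto simp: steiner_system_def)
  show "finite (Pow X)" using assms by (simp add: steiner_system_def)
qed

text \<open>The pairs in \<open>X\<close> are split among the blocks: existence of a block through
  each pair gives the covering, uniqueness the disjointness. Each block contributes
  \<open>r choose 2\<close> pairs.\<close>

lemma steiner_system_card_blocks:
  assumes st: "steiner_system r v X \<B>"
  shows "card \<B> * (r choose 2) = v choose 2"
proof -
  let ?P = "\<lambda>A. {e. e \<subseteq> A \<and> card e = 2}"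
  have X: "finite X" "card X = v" and B: "\<And>B. B \<in> \<B> \<Longrightarrow> B \<subseteq> X \<and> card B = r"
    using st by (auto simp: steiner_system_def)
  have finB: "finite B" if "B \<in> \<B>" for B
    using that B X(1) finite_subset by blast
  have "?P X = (\<Union>B\<in>\<B>. ?P B)"
  proof
    show "?P X \<subseteq> (\<Union>B\<in>\<B>. ?P B)"
    proof
      fix e assume "e \<in> ?P X"
      then show "e \<in> (\<Union>B\<in>\<B>. ?P B)"
        using steiner_system_ex1_block[OF st, of e] by auto
    qed
    show "(\<Union>B\<in>\<B>. ?P B) \<subseteq> ?P X"
      using B by blast
  qed
  then have "card (?P X) = card (\<Union>B\<in>\<B>. ?P B)" by simp
  also have "\<dots> = (\<Sum>B\<in>\<B>. card (?P B))"
  proof (rule card_UN_disjoint)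
    show "finite \<B>" by (rule steiner_system_finite_blocks[OF st])
    show "\<forall>B\<in>\<B>. finite (?P B)" using finB by simp
    show "\<forall>B\<in>\<B>. \<forall>C\<in>\<B>. B \<noteq> C \<longrightarrow> ?P B \<inter> ?P C = {}"
    proof (intro ballI impI)
      fix B C assume BC: "B \<in> \<B>" "C \<in> \<B>" "B \<noteq> C"
      have False if "e \<in> ?P B \<inter> ?P C" for e
      proof -
        have "e \<subseteq> X" "card e = 2" using that B BC by auto
        then show False
          using steiner_system_ex1_block[OF st, of e] that BC by auto
      qed
      then show "?P B \<inter> ?P C = {}" by blast
    qed
  qed
  also have "\<dots> = card \<B> * (r choose 2)"
    using finB B by (simp add: n_subsets)
  finally show ?thesis
    using X by (simp add: n_subsets)
qed

text \<open>Two vertices of an edge may lie over the same point, so \<open>C\<close> may be a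
  singleton. It extends to a pair inside \<open>X\<close> because \<open>v \<ge> 2\<close>, and the
  block through that pair contains \<open>C\<close>.\<close>

lemma steiner_system_cover:
  assumes st: "steiner_system r v X \<B>" and "v \<ge> 2" "C \<subseteq> X" "C \<noteq> {}" "card C \<le> 2"
  obtains B where "B \<in> \<B>" "C \<subseteq> B"
proof -
  have X: "finite X" "card X = v" using st by (auto simp: steiner_system_def)
  obtain e where "C \<subseteq> e" "e \<subseteq> X" "card e = 2"
    using exists_subset_between[of C 2 X] assms X by blast
  then show thesis
    using steiner_system_ex1_block[OF st, of e] that by blast
qed

text \<open>This is the blow-up: \<open>V\<close> is identified with
  \<open>X \<times> {..<m}\<close>, and \<open>c\<close> is the projection to \<open>X\<close>, so
  the vertices over \<open>B\<close> correspond to \<open>B \<times> {..<m}\<close>.\<close>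

lemma ex_equitable_map:
  assumes "finite X" "finite V" "card V = card X * m"
  obtains c where "c \<in> V \<rightarrow> X" "\<And>B. B \<subseteq> X \<Longrightarrow> card {u \<in> V. c u \<in> B} = card B * m"
proof -
  have "card V = card (X \<times> {..<m})" by (simp add: assms card_cartesian_product)
  then obtain h where h: "bij_betw h V (X \<times> {..<m})"
    using assms by (meson finite_SigmaI finite_lessThan finite_same_card_bij)
  show thesis
  proof
    show "fst \<circ> h \<in> V \<rightarrow> X"
      using bij_betwE[OF h] by fastforce
    fix B assume "B \<subseteq> X"
    have "h ` {u \<in> V. (fst \<circ> h) u \<in> B} = {p \<in> h ` V. fst p \<in> B}"
      by auto
    also have "\<dots> = B \<times> {..<m}"
      using \<open>B \<subseteq> X\<close> bij_betw_imp_surj_on[OF h] by auto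
    finally have "h ` {u \<in> V. (fst \<circ> h) u \<in> B} = B \<times> {..<m}" .
    then have "bij_betw h {u \<in> V. (fst \<circ> h) u \<in> B} (B \<times> {..<m})"
      using bij_betw_subset[OF h, of "{u \<in> V. (fst \<circ> h) u \<in> B}"] by auto
    then show "card {u \<in> V. (fst \<circ> h) u \<in> B} = card B * m"
      by (simp add: bij_betw_same_card card_cartesian_product)
  qed
qed

theorem theorem6p8:
  fixes v r k n :: nat and X :: "'a set" and \<B> :: "'a set set"
  assumes "r > 2" and "v > r"
    and "steiner_system r v X \<B>"
    and "real k = real v * (real v - 1) / (real r * (real r - 1))"
    and "n > 0" and "v dvd n"
  shows "M k n \<ge> real v / real r * (real n - 1)"
proof -
  note st = assms(3)
  have X: "finite X" "card X = v" and B: "\<And>B. B \<in> \<B> \<Longrightarrow> B \<subseteq> X \<and> card B = r"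
    using st by (auto simp: steiner_system_def)
  obtain m where n: "n = v * m" using assms(6) by blast
  have m: "m > 0" using assms(5) n by simp

  have "real (card \<B>) * (real r * (real r - 1)) = real v * (real v - 1)"
    using arg_cong[OF steiner_system_card_blocks[OF st], of real]
    by (simp add: real_choose_two)
  \<comment> \<open>The halves in the two binomials have cancelled; \<open>r > 2\<close> makes the
    divisor \<open>r * (r - 1)\<close> nonzero. There are thus exactly as many blocks as parts, and
    \<open>b\<close> matches them.\<close>
  then have "real (card \<B>) = real k"
    unfolding assms(4) using assms(1) by (intro eq_divide_imp) auto
  then have "card \<B> = k" by simp
  then obtain b where b: "bij_betw b {1..k} \<B>"
    using ex_bij_betw_nat_finite_1[OF steiner_system_finite_blocks[OF st]] by metis
  have bB: "b i \<subseteq> X" "card (b i) = r" if "i \<in> {1..k}" for i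
    using bij_betwE[OF b] B that by auto

  obtain c where c: "c \<in> {1..n} \<rightarrow> X"
    and fibre: "\<And>B. B \<subseteq> X \<Longrightarrow> card {u \<in> {1..n}. c u \<in> B} = card B * m"
    using ex_equitable_map[of X "{1..n}" m] X n by auto
  define E where "E = edges (complete_graph n)"
  have E: "E = {e. e \<subseteq> {1..n} \<and> card e = 2}"
    by (simp add: E_def complete_graph_def)
  have finE: "finite E" by (simp add: E)
  have "\<exists>i\<in>{1..k}. c ` e \<subseteq> b i" if "e \<in> E" for e
  proof -
    have e: "e \<subseteq> {1..n}" "card e = 2" using that by (auto simp: E)
    then have "finite e" "e \<noteq> {}" using card.infinite by fastforce+
    then have "c ` e \<noteq> {}" "card (c ` e) \<le> 2"
      using card_image_le[of e c] e by auto
    moreover have "c ` e \<subseteq> X" using c e by auto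
    ultimately obtain B' where "B' \<in> \<B>" "c ` e \<subseteq> B'"
      using steiner_system_cover[OF st, of "c ` e"] assms(1,2) by auto
    then show ?thesis using bij_betw_imp_surj_on[OF b] by blast
  qed
  then obtain f where f: "\<And>e. e \<in> E \<Longrightarrow> f e \<in> {1..k} \<and> c ` e \<subseteq> b (f e)"
    by metis
  define F where "F i = {e \<in> E. f e = i}" for i
  define G where "G i = ({1..n}, F i)" for i
  have part: "edge_partition k (complete_graph n) G"
    using edge_partition_fibres[of "complete_graph n" f k] f
    by (simp add: G_def[abs_def] F_def E_def complete_graph_def simple_graph_def)

  have Mad: "2 * real (card (F i)) / (real r * real m) \<le> Mad (G i)" if i: "i \<in> {1..k}" for i
  proof -
    \<comment> \<open>\<open>W\<close> is the blow-up of the block \<open>b i\<close>. Restricting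
      \<open>G i\<close> to \<open>W\<close> loses no edge, since \<open>f\<close> sends an edge to
      \<open>i\<close> only if both of its ends lie over \<open>b i\<close>; so
      \<open>(W, F i)\<close> witnesses the bound.\<close>
    define W where "W = {u \<in> {1..n}. c u \<in> b i}"
    have W: "card W = r * m" using fibre[OF bB(1)[OF i]] bB(2)[OF i] by (simp add: W_def)
    then have "W \<noteq> {}" using m assms(1) by auto
    moreover have "e \<subseteq> W" "card e = 2" if "e \<in> F i" for e
      using that f[of e] unfolding F_def W_def E by auto
    then have "subgraph (W, F i) (G i)"
      by (auto simp: subgraph_def simple_graph_def G_def W_def)
    ultimately show ?thesis
      using Mad_ge[of "G i" "(W, F i)"] W by (simp add: G_def)
  qed

  have "(\<Sum>i=1..k. card (F i)) = card (\<Union>i\<in>{1..k}. F i)"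
    using finE by (subst card_UN_disjoint) (auto simp: F_def)
  also have "(\<Union>i\<in>{1..k}. F i) = E"
    using f by (auto simp: F_def)
  also have "card E = n choose 2"
    by (simp add: E n_subsets)
  finally have cardF: "(\<Sum>i=1..k. real (card (F i))) = real n * (real n - 1) / 2"
    by (simp add: real_choose_two flip: of_nat_sum)

  \<comment> \<open>Since all the bounds share the denominator \<open>r * m\<close>, only the total
    number of edges matters; \<open>n = v * m\<close> turns \<open>v / r\<close> into
    \<open>n / (r * m)\<close>.\<close>
  have "real v / real r * (real n - 1) = real n * (real n - 1) / (real r * real m)"
    using m assms(1) by (simp add: n field_simps)
  also have "\<dots> = (\<Sum>i=1..k. 2 * real (card (F i)) / (real r * real m))"
    using cardF by (simp flip: sum_divide_distrib sum_distrib_left)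
  also have "\<dots> \<le> (\<Sum>i=1..k. Mad (G i))"
    by (intro sum_mono Mad)
  also have "\<dots> \<le> M k n"
    by (rule M_ge[OF part])
  finally show ?thesis .
qed

end
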